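(* Consider the generalized (dependent) LRU stack model in which, for every finite sequence $\zeta$ of past stack depths, the conditional distribution $s_\zeta(i)=\Pr[d_t=i\mid\zeta]$ of the next stack depth is non-increasing in $i$. Then for every trace length $L$, every sequence $\zeta$ of length at most $L$, and all states $y,z$ with $y\le_c z$, we have $J^*_L(\zeta,y)\le J^*_L(\zeta,z)$; and LRU is an optimal eviction policy for any initial buffer content.
   Context: There are $V$ items and a buffer of fixed capacity $C$; the LRU stack lists items in order of most recent access, and an access at stack depth $d$ moves the item at depth $d$ to the top, shifting positions $1,\dots,d-1$ down by one. A state is a vector $x\in\{0,1\}^V$ with $x(j)=1$ iff the item at LRU depth $j$ is in the buffer. A stack depth $d$ with $x(d)=0$ is a miss: the accessed item is brought in and, the buffer being full, a buffered item other than the accessed one is evicted. The trace has length $L$; after a prefix of stack depths $\zeta$ of length $|\zeta|$, the next depth $d$ has distribution $s_\zeta$. $J^*_L(\zeta,x)$ is the minimum, over eviction policies (which may depend on the history and the current access), of the expected number of misses in the remaining $L-|\zeta|$ accesses, given prefix $\zeta$ and current state $x$; it satisfies $J^*_L(\zeta,x)=\mathbb E_d[\min_u\{g(x,d)+J^*_L(\zeta d,f(x,d,u))\}\mid\zeta]$ with $g(x,d)=1$ if $x(d)=0$ and $0$ otherwise, and $f$ the state transition under eviction choice $u$. Critical pair: $y<_c z$ if, as strings, $y=1\nu1\iota0\sigma$ and $z=1\nu0\iota1\sigma$ for arbitrary binary strings $\nu,\iota$ and $\sigma\in 0^*$; $y\le_c z$ means $y=z$ or $y<_c z$. LRU evicts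 the least recently accessed buffered item. *)

theory Defs
  imports "HOL-Probability.Probability"
begin

text \<open>
  Stack depths are 1-based, whereas list positions are 0-based: the item at LRU depth \<open>j\<close>
  of a state \<open>x\<close> is buffered iff \<open>x ! (j - 1)\<close>.
\<close>

type_synonym state = "bool list"

definition buffered :: "state \<Rightarrow> nat \<Rightarrow> bool" where
  "buffered x j \<longleftrightarrow> x ! (j - 1)"

text \<open>The buffer is always full: exactly \<open>C\<close> of the \<open>V\<close> items are in it.\<close>

definition states :: "nat \<Rightarrow> nat \<Rightarrow> state set" where
  "states V C = {x. length x = V \<and> card {j \<in> {1..V}. buffered x j} = C}"

definition miss_cost :: "state \<Rightarrow> nat \<Rightarrow> nat" where
  "miss_cost x d = (if buffered x d then 0 else 1)"

definition move_to_top :: "nat \<Rightarrow> state \<Rightarrow> state" where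
  "move_to_top d x = True # take (d - 1) x @ drop d x"

text \<open>
  The choice \<open>u\<close> is the depth, before the access, of the evicted item; it is ignored on a hit.
\<close>

definition next_state :: "state \<Rightarrow> nat \<Rightarrow> nat \<Rightarrow> state" where
  "next_state x d u =
     move_to_top d (if buffered x d then x else x[u - 1 := False])"

text \<open>
  The argument \<open>s\<close> gives, for each prefix of past depths (oldest first), the law of the next depth.
\<close>

definition generalized_lru_stack_model :: "nat \<Rightarrow> (nat list \<Rightarrow> nat pmf) \<Rightarrow> bool" where
  "generalized_lru_stack_model V s \<longleftrightarrow>
     (\<forall>\<zeta>. set \<zeta> \<subseteq> {1..V} \<longrightarrow>
        set_pmf (s \<zeta>) \<subseteq> {1..V} \<and>
        antimono_on {1..V} (pmf (s \<zeta>)))"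

text \<open>The law of the next \<open>n\<close> depths given the prefix \<open>\<zeta>\<close>.\<close>

primrec trace_pmf :: "(nat list \<Rightarrow> nat pmf) \<Rightarrow> nat \<Rightarrow> nat list \<Rightarrow> nat list pmf" where
  "trace_pmf s 0 \<zeta> = return_pmf []"
| "trace_pmf s (Suc n) \<zeta> =
     bind_pmf (s \<zeta>) (\<lambda>d. map_pmf ((#) d) (trace_pmf s n (\<zeta> @ [d])))"

text \<open>
  A policy maps past depths, current state and accessed depth to the depth to evict. Given the
  state from which it is started, the past depths determine all states visited since then, so this
  covers all deterministic history-dependent policies.
\<close>

type_synonym policy = "nat list \<Rightarrow> state \<Rightarrow> nat \<Rightarrow> nat"

text \<open>
  On a miss the accessed item is not buffered in \<open>x\<close>, so a choice that is buffered in \<open>x\<close> is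
  automatically different from it.
\<close>

definition policies :: "nat \<Rightarrow> nat \<Rightarrow> policy set" where
  "policies V C =
     {\<pi>. \<forall>\<zeta> x d. set \<zeta> \<subseteq> {1..V} \<and> x \<in> states V C \<and> d \<in> {1..V} \<and> \<not> buffered x d \<longrightarrow>
            \<pi> \<zeta> x d \<in> {u \<in> {1..V}. buffered x u}}"

primrec misses :: "policy \<Rightarrow> nat list \<Rightarrow> state \<Rightarrow> nat list \<Rightarrow> nat" where
  "misses \<pi> \<zeta> x [] = 0"
| "misses \<pi> \<zeta> x (d # ds) =
     miss_cost x d + misses \<pi> (\<zeta> @ [d]) (next_state x d (\<pi> \<zeta> x d)) ds"

definition expected_misses ::
  "(nat list \<Rightarrow> nat pmf) \<Rightarrow> nat \<Rightarrow> policy \<Rightarrow> nat list \<Rightarrow> state \<Rightarrow> real" where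
  "expected_misses s L \<pi> \<zeta> x =
     measure_pmf.expectation (trace_pmf s (L - length \<zeta>) \<zeta>) (\<lambda>ds. real (misses \<pi> \<zeta> x ds))"

definition Jstar ::
  "nat \<Rightarrow> nat \<Rightarrow> (nat list \<Rightarrow> nat pmf) \<Rightarrow> nat \<Rightarrow> nat list \<Rightarrow> state \<Rightarrow> real" where
  "Jstar V C s L \<zeta> x = (INF \<pi> \<in> policies V C. expected_misses s L \<pi> \<zeta> x)"

definition optimal_policy ::
  "nat \<Rightarrow> nat \<Rightarrow> (nat list \<Rightarrow> nat pmf) \<Rightarrow> nat \<Rightarrow> state \<Rightarrow> policy \<Rightarrow> bool" where
  "optimal_policy V C s L x \<pi> \<longleftrightarrow>
     \<pi> \<in> policies V C \<and>
     (\<forall>\<pi>' \<in> policies V C. expected_misses s L \<pi> [] x \<le> expected_misses s L \<pi>' [] x)"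

definition lru :: policy where
  "lru \<zeta> x d = Max {u \<in> {1..length x}. buffered x u}"

definition critical_less :: "state \<Rightarrow> state \<Rightarrow> bool"  (infix "<\<^sub>c" 50) where
  "y <\<^sub>c z \<longleftrightarrow>
     (\<exists>\<nu> \<iota> \<sigma>. set \<sigma> \<subseteq> {False} \<and>
        y = [True] @ \<nu> @ [True] @ \<iota> @ [False] @ \<sigma> \<and>
        z = [True] @ \<nu> @ [False] @ \<iota> @ [True] @ \<sigma>)"

definition critical_le :: "state \<Rightarrow> state \<Rightarrow> bool"  (infix "\<le>\<^sub>c" 50) where
  "y \<le>\<^sub>c z \<longleftrightarrow> y = z \<or> y <\<^sub>c z"

end

theory Submission
  imports Defs
begin

text \<open>
  If both components of a critical pair evict their least recently used item, the successors are
  again equal or critical, whatever depth is accessed. The one-step miss probabilities differ only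
  at the two depths where the states differ, and there the better state holds the shallower, hence
  likelier, item. Thus the cost of LRU is monotone along critical pairs by induction on the number
  of remaining accesses. On a miss, evicting the least recently used item leads to a state that is
  critically below the one reached by any other eviction, so LRU attains the optimum.
\<close>

section \<open>Moving to the top and critical pairs, position by position\<close>

lemma length_move_to_top: "d \<in> {1..length x} \<Longrightarrow> length (move_to_top d x) = length x"
  by (auto simp: move_to_top_def)

lemma nth_move_to_top:
  assumes "d \<in> {1..length x}" "j < length x"
  shows "move_to_top d x ! j = (if j = 0 then True else if j < d then x ! (j - 1) else x ! j)"
  using assms by (auto simp: move_to_top_def nth_Cons nth_append min_def split: nat.split)

lemma nth_0_move_to_top: "move_to_top d x ! 0"
  by (simp add: move_to_top_def)

text \<open>The accessed bit is deleted and replaced by the leading \<open>True\<close>, so states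
  that differ only there become equal.\<close>

lemma move_to_top_cong:
  assumes "length x = length x'" "d \<in> {1..length x}"
    and "\<And>j. j < length x \<Longrightarrow> j \<noteq> d - 1 \<Longrightarrow> x ! j = x' ! j"
  shows "move_to_top d x = move_to_top d x'"
proof (rule nth_equalityI)
  show "length (move_to_top d x) = length (move_to_top d x')"
    using assms by (simp add: length_move_to_top)
next
  fix j assume "j < length (move_to_top d x)"
  then show "move_to_top d x ! j = move_to_top d x' ! j"
    using assms by (auto simp: length_move_to_top nth_move_to_top)
qed

text \<open>Index form of \<open><\<^sub>c\<close>: \<open>p\<close> and \<open>q\<close> are the
  0-based positions of the two differing bits. It lets moves and evictions be checked with
  \<open>nth\<close> instead of by splitting strings.\<close>

definition critical_at :: "nat \<Rightarrow> nat \<Rightarrow> state \<Rightarrow> state \<Rightarrow> bool" where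
  "critical_at p q y z \<longleftrightarrow>
     length y = length z \<and> 0 < p \<and> p < q \<and> q < length z \<and> y ! 0 \<and>
     y ! p \<and> \<not> z ! p \<and> \<not> y ! q \<and> z ! q \<and>
     (\<forall>j < length z. j \<noteq> p \<longrightarrow> j \<noteq> q \<longrightarrow> y ! j = z ! j) \<and>
     (\<forall>j < length z. q < j \<longrightarrow> \<not> z ! j)"

lemma critical_lessE:
  assumes "y <\<^sub>c z"
  obtains p q where "critical_at p q y z"
proof -
  from assms obtain \<nu> \<iota> \<sigma> where s: "set \<sigma> \<subseteq> {False}"
    and y: "y = [True] @ \<nu> @ [True] @ \<iota> @ [False] @ \<sigma>"
    and z: "z = [True] @ \<nu> @ [False] @ \<iota> @ [True] @ \<sigma>"
    unfolding critical_less_def by blast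
  have "\<not> \<sigma> ! j" if "j < length \<sigma>" for j
    using s nth_mem[OF that] by blast
  then have "critical_at (Suc (length \<nu>)) (Suc (Suc (length \<nu> + length \<iota>))) y z"
    unfolding critical_at_def y z
    by (auto simp: nth_append nth_Cons split: nat.splits)
  then show thesis by (rule that)
qed

lemma split_at_three:
  assumes "0 < p" "p < q" "q < length x"
  shows "x = [x ! 0] @ take (p - 1) (drop 1 x) @ [x ! p] @ take (q - p - 1) (drop (Suc p) x)
           @ [x ! q] @ drop (Suc q) x"
proof -
  have q: "drop (Suc p) x = take (q - p - 1) (drop (Suc p) x) @ x ! q # drop (Suc q) x"
    using id_take_nth_drop[of "q - p - 1" "drop (Suc p) x"] assms by simp
  have "take p x = x ! 0 # take (p - 1) (drop 1 x)"
    using assms by (cases x; cases p) auto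
  moreover have "x = take p x @ x ! p # drop (Suc p) x"
    using assms by (intro id_take_nth_drop) simp
  ultimately have "x = x ! 0 # take (p - 1) (drop 1 x) @ x ! p # drop (Suc p) x"
    by simp
  with q show ?thesis by simp
qed

lemma critical_at_imp_less:
  assumes "critical_at p q y z"
  shows "y <\<^sub>c z"
proof -
  define \<nu> where "\<nu> = take (p - 1) (drop 1 y)"
  define \<iota> where "\<iota> = take (q - p - 1) (drop (Suc p) y)"
  define \<sigma> where "\<sigma> = drop (Suc q) y"
  note c = assms[unfolded critical_at_def]
  have "\<forall>j < length z. j \<noteq> p \<longrightarrow> j \<noteq> q \<longrightarrow> y ! j = z ! j" and "y ! 0"
    using c by blast+
  then have "z ! 0" using c by (metis less_nat_zero_code less_trans)
  have "take (p - 1) (drop 1 z) = \<nu>"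
    unfolding \<nu>_def by (rule nth_equalityI) (use c in auto)
  moreover have "take (q - p - 1) (drop (Suc p) z) = \<iota>"
    unfolding \<iota>_def by (rule nth_equalityI) (use c in auto)
  moreover have "drop (Suc q) z = \<sigma>"
    unfolding \<sigma>_def by (rule nth_equalityI) (use c in auto)
  ultimately have z: "z = [True] @ \<nu> @ [False] @ \<iota> @ [True] @ \<sigma>"
    using split_at_three[of p q z] c \<open>z ! 0\<close> by simp
  have y: "y = [True] @ \<nu> @ [True] @ \<iota> @ [False] @ \<sigma>"
    using split_at_three[of p q y] c \<open>y ! 0\<close> by (simp add: \<nu>_def \<iota>_def \<sigma>_def)
  have "set \<sigma> \<subseteq> {False}"
    using c by (auto simp: \<sigma>_def in_set_conv_nth)
  with y z show ?thesis unfolding critical_less_def by blast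
qed

text \<open>The move shifts the two differing bits without changing their order and erases position
  \<open>d - 1\<close>, so nothing is asked of the states there. It also supplies the leading
  \<open>True\<close>, so \<open>p = 0\<close> is allowed and the states themselves may start with
  \<open>False\<close>.\<close>

lemma move_to_top_critical:
  assumes len: "length y = length z" "d \<in> {1..length z}"
    and pq: "p < q" "q < length z" "d - 1 \<noteq> p" "d - 1 \<noteq> q"
    and bits: "y ! p" "\<not> z ! p" "\<not> y ! q" "z ! q"
    and eq: "\<And>j. j < length z \<Longrightarrow> j \<noteq> p \<Longrightarrow> j \<noteq> q \<Longrightarrow> j \<noteq> d - 1 \<Longrightarrow> y ! j = z ! j"
    and zero: "\<And>j. j < length z \<Longrightarrow> q < j \<Longrightarrow> j \<noteq> d - 1 \<Longrightarrow> \<not> z ! j"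
  shows "move_to_top d y <\<^sub>c move_to_top d z"
proof -
  \<comment> \<open>\<open>sh k\<close> is the position after the move of the item at position
    \<open>k\<close>, for \<open>k\<close> other than \<open>d - 1\<close>.\<close>
  define sh where "sh k = (if k < d - 1 then Suc k else k)" for k
  have "critical_at (sh p) (sh q) (move_to_top d y) (move_to_top d z)"
    unfolding critical_at_def using assms
    by (auto simp: length_move_to_top nth_0_move_to_top nth_move_to_top sh_def split: if_splits)
  then show ?thesis by (rule critical_at_imp_less)
qed

section \<open>LRU evictions and critical pairs\<close>

lemma lru_eqI:
  assumes "m < length x" "x ! m" "\<And>j. j < length x \<Longrightarrow> m < j \<Longrightarrow> \<not> x ! j"
  shows "lru \<zeta> x d = Suc m"
  unfolding lru_def
proof (rule Max_eqI)
  fix u assume u: "u \<in> {u \<in> {1..length x}. buffered x u}"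
  then obtain j where "u = Suc j" "j < length x" "x ! j"
    by (cases u) (auto simp: buffered_def)
  with assms(3) show "u \<le> Suc m" by (metis Suc_le_mono leI)
qed (use assms in \<open>auto simp: buffered_def\<close>)

lemma ex_last_buffered:
  fixes x :: state
  assumes "i < length x" "x ! i"
  shows "\<exists>m\<ge>i. m < length x \<and> x ! m \<and> (\<forall>j < length x. m < j \<longrightarrow> \<not> x ! j)"
proof -
  let ?S = "{j. j < length x \<and> x ! j}"
  have fin: "finite ?S" by simp
  have "Max ?S \<in> ?S" using assms by (intro Max_in fin) auto
  moreover have le: "j \<le> Max ?S" if "j < length x" "x ! j" for j
    using that by (intro Max_ge fin) simp
  ultimately show ?thesis
    using assms by (intro exI[of _ "Max ?S"]) (auto simp: not_le[symmetric])
qed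

text \<open>LRU evicts position \<open>q\<close> from \<open>z\<close> and the last buffered
  position \<open>m\<close> from \<open>y\<close>, where \<open>p \<le> m < q\<close>. If only
  \<open>z\<close> misses, at \<open>p\<close>, the successors coincide. If both hit, the pair stays
  critical at the shifted \<open>p\<close> and \<open>q\<close>. If only \<open>y\<close> misses, at
  \<open>q\<close>, or both miss, the difference at \<open>q\<close> disappears; what remains is a
  difference at \<open>p\<close> and \<open>m\<close>, or none if \<open>m = p\<close>.\<close>

lemma next_state_lru_critical:
  assumes "y <\<^sub>c z" and d: "d \<in> {1..length z}"
  shows "next_state y d (lru \<zeta> y d) \<le>\<^sub>c next_state z d (lru \<zeta> z d)"
proof -
  from assms(1) obtain p q where cr: "critical_at p q y z" by (rule critical_lessE)
  note c = cr[unfolded critical_at_def]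
  obtain m where m: "p \<le> m" "m < length y" "y ! m"
      "\<And>j. j < length y \<Longrightarrow> m < j \<Longrightarrow> \<not> y ! j"
    using ex_last_buffered[of p y] c by auto
  have ly: "lru \<zeta> y d = Suc m" by (rule lru_eqI) (use m in auto)
  have lz: "lru \<zeta> z d = Suc q" by (rule lru_eqI) (use c in auto)
  \<comment> \<open>\<open>y ! q\<close> is false, and beyond \<open>q\<close> both states are
    empty.\<close>
  have mq: "m < q"
    using c m by (metis linorder_neqE_nat)
  consider "d - 1 = p" | "d - 1 = q" | "d - 1 \<noteq> p" "d - 1 \<noteq> q" "y ! (d - 1)"
    | "d - 1 \<noteq> p" "d - 1 \<noteq> q" "\<not> y ! (d - 1)" by blast
  then show ?thesis
  proof cases
    case 1
    have "move_to_top d y = move_to_top d (z[q := False])"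
      by (rule move_to_top_cong) (use c d 1 in \<open>auto simp: nth_list_update\<close>)
    then show ?thesis
      using c 1 by (auto simp: critical_le_def next_state_def buffered_def lz)
  next
    case 2
    have "move_to_top d (y[m := False]) \<le>\<^sub>c move_to_top d z"
    proof (cases "m = p")
      case True
      have "move_to_top d (y[m := False]) = move_to_top d z"
        by (rule move_to_top_cong) (use c d 2 True in \<open>auto simp: nth_list_update\<close>)
      then show ?thesis by (simp add: critical_le_def)
    next
      case False
      have "move_to_top d (y[m := False]) <\<^sub>c move_to_top d z"
      proof (rule move_to_top_critical[where p = p and q = m])
        \<comment> \<open>Beyond \<open>m\<close>, only \<open>q\<close> is buffered in
          \<open>z\<close>, and here \<open>q\<close> is the exempt position
          \<open>d - 1\<close>.\<close>
        show "\<not> z ! j" if "j < length z" "m < j" "j \<noteq> d - 1" for j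
          using that m(4)[of j] m(1) c 2 by auto
        show "z ! m" using m False c mq by auto
      qed (use c d 2 False m mq in \<open>auto simp: nth_list_update\<close>)
      then show ?thesis by (simp add: critical_le_def)
    qed
    then show ?thesis
      using c 2 by (auto simp: next_state_def buffered_def ly)
  next
    case 3
    have "move_to_top d y <\<^sub>c move_to_top d z"
      by (rule move_to_top_critical[where p = p and q = q]) (use c d 3 in auto)
    moreover have "z ! (d - 1)" using c d 3 by auto
    ultimately show ?thesis
      using 3 by (auto simp: critical_le_def next_state_def buffered_def)
  next
    case 4
    have nz: "\<not> z ! (d - 1)" using c d 4 by auto
    have "move_to_top d (y[m := False]) \<le>\<^sub>c move_to_top d (z[q := False])"
    proof (cases "m = p")
      case True
      have "move_to_top d (y[m := False]) = move_to_top d (z[q := False])"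
        by (rule move_to_top_cong) (use c d True in \<open>auto simp: nth_list_update\<close>)
      then show ?thesis by (simp add: critical_le_def)
    next
      case False
      have "move_to_top d (y[m := False]) <\<^sub>c move_to_top d (z[q := False])"
      proof (rule move_to_top_critical[where p = p and q = m])
        show "\<not> z[q := False] ! j" if "j < length (z[q := False])" "m < j" "j \<noteq> d - 1" for j
          using that m(4)[of j] m(1) c by (auto simp: nth_list_update)
        show "z[q := False] ! m" using m False c mq by auto
        show "d - 1 \<noteq> m" using m 4 by auto
      qed (use c d 4 False m mq in \<open>auto simp: nth_list_update\<close>)
      then show ?thesis by (simp add: critical_le_def)
    qed
    then show ?thesis using nz 4 by (simp add: next_state_def buffered_def ly lz)
  qed
qed

text \<open>Let \<open>m\<close> be the last buffered position. Evicting \<open>m\<close> keeps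
  \<open>u - 1\<close> and evicting \<open>u - 1\<close> keeps \<open>m\<close>; nothing beyond
  \<open>m\<close> is buffered. The move turns this into a critical pair, even if
  \<open>u - 1 = 0\<close>.\<close>

lemma next_state_lru_le:
  assumes d: "d \<in> {1..length x}" and u: "u \<in> {1..length x}" "buffered x u"
  shows "next_state x d (lru \<zeta> x d) \<le>\<^sub>c next_state x d u"
proof (cases "buffered x d")
  case True
  then show ?thesis by (simp add: next_state_def critical_le_def)
next
  case False
  have "u - 1 < length x" "x ! (u - 1)" using u by (auto simp: buffered_def)
  then obtain m where m: "u - 1 \<le> m" "m < length x" "x ! m"
      "\<And>j. j < length x \<Longrightarrow> m < j \<Longrightarrow> \<not> x ! j"
    using ex_last_buffered by blast
  have l: "lru \<zeta> x d = Suc m" by (rule lru_eqI) (use m in auto)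
  show ?thesis
  proof (cases "m = u - 1")
    case True
    then show ?thesis using l by (simp add: next_state_def critical_le_def)
  next
    case neq: False
    have "move_to_top d (x[m := False]) <\<^sub>c move_to_top d (x[u - 1 := False])"
      by (rule move_to_top_critical[where p = "u - 1" and q = m])
        (use d u m neq False in \<open>auto simp: nth_list_update buffered_def\<close>)
    then show ?thesis using False l by (simp add: next_state_def critical_le_def)
  qed
qed

section \<open>Evictions keep the buffer full, and LRU is admissible\<close>

lemma states_iff: "x \<in> states V C \<longleftrightarrow> length x = V \<and> count (mset x) True = C"
proof -
  have "card {j \<in> {1..length x}. buffered x j} = card {i. i < length x \<and> x ! i}"
    by (rule card_bij_eq[of "\<lambda>j. j - 1" _ _ Suc])
      (auto simp: inj_on_def buffered_def)
  also have "\<dots> = length (filter (\<lambda>b. b) x)"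
    by (simp add: length_filter_conv_card)
  also have "\<dots> = count (mset x) True"
    by (induction x) auto
  finally show ?thesis by (auto simp: states_def)
qed

text \<open>The move trades the accessed bit for a \<open>True\<close>. Adding the lost bit on the
  left avoids multiset subtraction.\<close>

lemma mset_move_to_top:
  assumes "d \<in> {1..length x}"
  shows "add_mset (x ! (d - 1)) (mset (move_to_top d x)) = add_mset True (mset x)"
proof -
  have "mset x = mset (take (d - 1) x @ x ! (d - 1) # drop (Suc (d - 1)) x)"
    using assms by (subst id_take_nth_drop[of "d - 1" x]) auto
  then show ?thesis using assms by (simp add: move_to_top_def)
qed

lemma next_state_in_states:
  assumes x: "x \<in> states V C" and d: "d \<in> {1..V}"
    and u: "\<not> buffered x d \<Longrightarrow> u \<in> {1..V} \<and> buffered x u"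
  shows "next_state x d u \<in> states V C"
proof -
  from x have len: "length x = V" and cnt: "count (mset x) True = C"
    by (simp_all add: states_iff)
  show ?thesis
  proof (cases "buffered x d")
    case True
    then show ?thesis
      using mset_move_to_top[of d x] d len cnt
      by (simp add: next_state_def states_iff length_move_to_top buffered_def)
  next
    case False
    with u have u': "u \<in> {1..V}" "x ! (u - 1)" by (auto simp: buffered_def)
    let ?x = "x[u - 1 := False]"
    have i: "u - 1 < length x" using u' len by auto
    have "True \<in># mset x" using u' nth_mem[OF i] by simp
    then have eq: "add_mset True (mset ?x) = add_mset False (mset x)"
      unfolding mset_update[OF i] using u' by (simp add: add_mset_commute[of True False])
    have C: "Suc (count (mset ?x) True) = C"
      using arg_cong[OF eq, of "\<lambda>M. count M True"] cnt by simp
    \<comment> \<open>The move trades a \<open>False\<close> for a \<open>True\<close>, which makes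
      up for the evicted item.\<close>
    have "\<not> ?x ! (d - 1)" using False d len u'
      by (auto simp: buffered_def nth_list_update split: if_splits)
    then have "count (mset (move_to_top d ?x)) True = Suc (count (mset ?x) True)"
      using arg_cong[OF mset_move_to_top[of d ?x], of "\<lambda>M. count M True"] d len by simp
    then show ?thesis
      using False C d len by (simp add: next_state_def states_iff length_move_to_top)
  qed
qed

lemma lru_in_policies:
  assumes "1 \<le> C"
  shows "lru \<in> policies V C"
  unfolding policies_def
proof (rule CollectI, intro allI impI)
  fix \<zeta> :: "nat list" and x d
  assume "set \<zeta> \<subseteq> {1..V} \<and> x \<in> states V C \<and> d \<in> {1..V} \<and> \<not> buffered x d"
  then have len: "length x = V" and card: "card {u \<in> {1..V}. buffered x u} = C"
    by (auto simp: states_def)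
  \<comment> \<open>The \<open>Max\<close> in \<open>lru\<close> is a member of this set only
    because the buffer is nonempty.\<close>
  have "{u \<in> {1..V}. buffered x u} \<noteq> {}"
    using card assms by (metis card.empty not_one_le_zero)
  then have "Max {u \<in> {1..V}. buffered x u} \<in> {u \<in> {1..V}. buffered x u}"
    by (intro Max_in) auto
  then show "lru \<zeta> x d \<in> {u \<in> {1..V}. buffered x u}" unfolding lru_def len .
qed

section \<open>Expected cost by number of remaining accesses, and optimality of LRU\<close>

abbreviation cost_to_go ::
  "(nat list \<Rightarrow> nat pmf) \<Rightarrow> policy \<Rightarrow> nat \<Rightarrow> nat list \<Rightarrow> state \<Rightarrow> real" where
  "cost_to_go s \<pi> n \<zeta> x \<equiv>
     measure_pmf.expectation (trace_pmf s n \<zeta>) (\<lambda>ds. real (misses \<pi> \<zeta> x ds))"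

locale lru_stack_model =
  fixes V C :: nat and s :: "nat list \<Rightarrow> nat pmf"
  assumes C_pos: "1 \<le> C" and model: "generalized_lru_stack_model V s"
begin

lemma set_pmf_depth: "set \<zeta> \<subseteq> {1..V} \<Longrightarrow> set_pmf (s \<zeta>) \<subseteq> {1..V}"
  using model by (auto simp: generalized_lru_stack_model_def)

lemma pmf_depth_antimono:
  "set \<zeta> \<subseteq> {1..V} \<Longrightarrow> i \<in> {1..V} \<Longrightarrow> j \<in> {1..V} \<Longrightarrow> i \<le> j \<Longrightarrow> pmf (s \<zeta>) j \<le> pmf (s \<zeta>) i"
  using model unfolding generalized_lru_stack_model_def monotone_on_def by blast

text \<open>Finite support makes every expectation below a finite sum, so integrability is
  automatic.\<close>

lemma finite_trace: "set \<zeta> \<subseteq> {1..V} \<Longrightarrow> finite (set_pmf (trace_pmf s n \<zeta>))"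
proof (induction n arbitrary: \<zeta>)
  case (Suc n)
  have "finite (set_pmf (s \<zeta>))"
    using set_pmf_depth[OF Suc.prems] by (rule finite_subset) simp
  moreover have "finite (set_pmf (trace_pmf s n (\<zeta> @ [d])))" if "d \<in> set_pmf (s \<zeta>)" for d
    using that set_pmf_depth[OF Suc.prems] Suc.prems by (intro Suc.IH) auto
  ultimately show ?case by simp
qed simp

text \<open>Conditioning on the next depth gives the dynamic programming recursion for a fixed
  policy, without the minimum.\<close>

lemma cost_to_go_Suc:
  assumes "set \<zeta> \<subseteq> {1..V}"
  shows "cost_to_go s \<pi> (Suc n) \<zeta> x =
    (\<Sum>d\<in>{1..V}. pmf (s \<zeta>) d *
       (real (miss_cost x d) + cost_to_go s \<pi> n (\<zeta> @ [d]) (next_state x d (\<pi> \<zeta> x d))))"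
proof -
  have fin: "finite (set_pmf (trace_pmf s n (\<zeta> @ [d])))" if "d \<in> {1..V}" for d
    using that assms by (intro finite_trace) auto
  have "cost_to_go s \<pi> (Suc n) \<zeta> x =
      (\<Sum>d\<in>{1..V}. pmf (s \<zeta>) d *\<^sub>R
         measure_pmf.expectation (map_pmf ((#) d) (trace_pmf s n (\<zeta> @ [d])))
           (\<lambda>ds. real (misses \<pi> \<zeta> x ds)))"
    unfolding trace_pmf.simps
    by (rule pmf_expectation_bind) (use fin set_pmf_depth[OF assms] in auto)
  also have "\<dots> = (\<Sum>d\<in>{1..V}. pmf (s \<zeta>) d *
       (real (miss_cost x d) + cost_to_go s \<pi> n (\<zeta> @ [d]) (next_state x d (\<pi> \<zeta> x d))))"
    using fin by (intro sum.cong refl) (simp add: integrable_measure_pmf_finite)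
  finally show ?thesis .
qed

text \<open>Only \<open>z\<close> misses at depth \<open>Suc p\<close> and only \<open>y\<close>
  misses at depth \<open>Suc q\<close>, so the two sums differ by the difference of these two
  probabilities. This is where the monotonicity of the depth law enters.\<close>

lemma expected_miss_cost_critical:
  assumes \<zeta>: "set \<zeta> \<subseteq> {1..V}" and "y <\<^sub>c z" and len: "length z = V"
  shows "(\<Sum>d\<in>{1..V}. pmf (s \<zeta>) d * real (miss_cost y d))
       \<le> (\<Sum>d\<in>{1..V}. pmf (s \<zeta>) d * real (miss_cost z d))"
proof -
  from assms(2) obtain p q where "critical_at p q y z" by (rule critical_lessE)
  note c = this[unfolded critical_at_def]
  have "pmf (s \<zeta>) d * real (miss_cost z d) =
      pmf (s \<zeta>) d * real (miss_cost y d) + (if d = Suc p then pmf (s \<zeta>) d else 0)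
        - (if d = Suc q then pmf (s \<zeta>) d else 0)" if "d \<in> {1..V}" for d
    using that c len by (cases d) (auto simp: miss_cost_def buffered_def)
  then have "(\<Sum>d\<in>{1..V}. pmf (s \<zeta>) d * real (miss_cost z d)) =
      (\<Sum>d\<in>{1..V}. pmf (s \<zeta>) d * real (miss_cost y d)) + pmf (s \<zeta>) (Suc p) - pmf (s \<zeta>) (Suc q)"
    using c len by (simp add: sum.distrib sum_subtractf)
  moreover have "pmf (s \<zeta>) (Suc q) \<le> pmf (s \<zeta>) (Suc p)"
    using c len by (intro pmf_depth_antimono \<zeta>) auto
  ultimately show ?thesis by simp
qed

lemma cost_to_go_lru_critical:
  assumes "set \<zeta> \<subseteq> {1..V}" "y \<le>\<^sub>c z" "length z = V"
  shows "cost_to_go s lru n \<zeta> y \<le> cost_to_go s lru n \<zeta> z"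
  using assms
proof (induction n arbitrary: \<zeta> y z)
  case (Suc n)
  show ?case
  proof (cases "y = z")
    case False
    with Suc.prems have yz: "y <\<^sub>c z" by (simp add: critical_le_def)
    let ?E = "\<lambda>x d. cost_to_go s lru n (\<zeta> @ [d]) (next_state x d (lru \<zeta> x d))"
    have "?E y d \<le> ?E z d" if "d \<in> {1..V}" for d
    proof (rule Suc.IH)
      show "next_state y d (lru \<zeta> y d) \<le>\<^sub>c next_state z d (lru \<zeta> z d)"
        using that Suc.prems yz by (intro next_state_lru_critical) auto
    qed (use that Suc.prems in \<open>auto simp: next_state_def length_move_to_top\<close>)
    \<comment> \<open>Future costs compare depth by depth, but immediate costs only in expectation,
      since \<open>y\<close> alone misses at depth \<open>Suc q\<close>. Hence the two parts are
      summed separately.\<close>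
    then have "(\<Sum>d\<in>{1..V}. pmf (s \<zeta>) d * ?E y d) \<le> (\<Sum>d\<in>{1..V}. pmf (s \<zeta>) d * ?E z d)"
      by (intro sum_mono mult_left_mono) auto
    with expected_miss_cost_critical[OF Suc.prems(1) yz Suc.prems(3)] show ?thesis
      unfolding cost_to_go_Suc[OF Suc.prems(1)] by (simp add: distrib_left sum.distrib)
  qed simp
qed simp

text \<open>The immediate cost depends on \<open>x\<close> and \<open>d\<close> alone, so only the
  successors matter. Monotonicity along critical pairs compares the LRU successor with that of
  \<open>\<pi>\<close>, both continued by LRU; the induction hypothesis then replaces LRU by
  \<open>\<pi>\<close> in the continuation.\<close>

lemma cost_to_go_lru_le:
  assumes \<pi>: "\<pi> \<in> policies V C" and "set \<zeta> \<subseteq> {1..V}" "x \<in> states V C"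
  shows "cost_to_go s lru n \<zeta> x \<le> cost_to_go s \<pi> n \<zeta> x"
  using assms(2,3)
proof (induction n arbitrary: \<zeta> x)
  case (Suc n)
  have len: "length x = V" using Suc.prems by (simp add: states_iff)
  let ?x = "\<lambda>\<pi> d. next_state x d (\<pi> \<zeta> x d)"
  have "cost_to_go s lru n (\<zeta> @ [d]) (?x lru d) \<le> cost_to_go s \<pi> n (\<zeta> @ [d]) (?x \<pi> d)"
    if d: "d \<in> {1..V}" for d
  proof -
    have u: "\<pi> \<zeta> x d \<in> {1..V} \<and> buffered x (\<pi> \<zeta> x d)" if "\<not> buffered x d"
      using \<pi> that Suc.prems d unfolding policies_def by blast
    then have st: "?x \<pi> d \<in> states V C"
      using Suc.prems d by (intro next_state_in_states)
    have le: "?x lru d \<le>\<^sub>c ?x \<pi> d"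
    proof (cases "buffered x d")
      case True
      then show ?thesis by (simp add: next_state_def critical_le_def)
    next
      case False
      then show ?thesis using u d len by (intro next_state_lru_le) auto
    qed
    have \<zeta>: "set (\<zeta> @ [d]) \<subseteq> {1..V}" using Suc.prems d by auto
    have "cost_to_go s lru n (\<zeta> @ [d]) (?x lru d) \<le> cost_to_go s lru n (\<zeta> @ [d]) (?x \<pi> d)"
      using \<zeta> le st by (intro cost_to_go_lru_critical) (auto simp: states_iff)
    also have "\<dots> \<le> cost_to_go s \<pi> n (\<zeta> @ [d]) (?x \<pi> d)"
      by (rule Suc.IH[OF \<zeta> st])
    finally show ?thesis .
  qed
  then show ?case unfolding cost_to_go_Suc[OF Suc.prems(1)]
    by (intro sum_mono mult_left_mono add_left_mono) auto
qed simp

text \<open>The infimum is attained by LRU, so monotonicity of \<open>Jstar\<close> reduces to that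
  of the LRU cost.\<close>

lemma Jstar_eq_lru:
  assumes "set \<zeta> \<subseteq> {1..V}" "x \<in> states V C"
  shows "Jstar V C s L \<zeta> x = expected_misses s L lru \<zeta> x"
  unfolding Jstar_def
proof (rule cInf_eq_minimum)
  show "expected_misses s L lru \<zeta> x \<in> (\<lambda>\<pi>. expected_misses s L \<pi> \<zeta> x) ` policies V C"
    using lru_in_policies[OF C_pos] by blast
qed (auto simp: expected_misses_def intro!: cost_to_go_lru_le assms)

end

theorem theorem8:
  fixes V C :: nat and s :: "nat list \<Rightarrow> nat pmf"
  assumes "1 \<le> C" and "C \<le> V"
    and "generalized_lru_stack_model V s"
  shows "(\<forall>L \<zeta>. \<forall>y \<in> states V C. \<forall>z \<in> states V C.
            set \<zeta> \<subseteq> {1..V} \<and> length \<zeta> \<le> L \<and> y \<le>\<^sub>c z \<longrightarrow>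
            Jstar V C s L \<zeta> y \<le> Jstar V C s L \<zeta> z) \<and>
         (\<forall>L. \<forall>x \<in> states V C. optimal_policy V C s L x lru)"
proof -
  interpret lru_stack_model V C s by unfold_locales (use assms in auto)
  show ?thesis
  proof (intro conjI allI ballI impI)
    fix L \<zeta> y z
    assume "y \<in> states V C" "z \<in> states V C"
      and "set \<zeta> \<subseteq> {1..V} \<and> length \<zeta> \<le> L \<and> y \<le>\<^sub>c z"
    then show "Jstar V C s L \<zeta> y \<le> Jstar V C s L \<zeta> z"
      by (simp add: Jstar_eq_lru expected_misses_def cost_to_go_lru_critical states_iff)
  next
    fix L x assume "x \<in> states V C"
    then show "optimal_policy V C s L x lru"
      unfolding optimal_policy_def expected_misses_def
      by (auto intro!: lru_in_policies cost_to_go_lru_le C_pos)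
  qed
qed

end
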